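(* Assume that $0\in I$. Then we have the following assertions: (i) For all $n\in\mathbb{N}\setminus\{1\}$, the mean $\mathfrak{M}^{[n]}$ restricted to $I^n$ is not a (standard) quasiarithmetic mean on $I^n$, i.e., there is no strictly increasing and continuous function $f:I\to\mathbb{R}$ such that $\mathfrak{M}^{[n]}(x)=A_f^{[n]}(x)$ for all $x\in I^n$. (ii) For all $n\in\mathbb{N}\setminus\{1\}$, the mean $\mathfrak{M}^{[n]}$ restricted to $I^n$ is a generalized quasiarithmetic mean, that is, there exists a strictly increasing function $f:I\to\mathbb{R}$ such that $\mathfrak{M}^{[n]}(x)=A_f^{[n]}(x)$ for all $x\in I^n$, if and only if $I$ is bounded. (iii) There is no strictly increasing function $f:I\to\mathbb{R}$ such that, for all $n\in\mathbb{N}$, the equality $\mathfrak{M}^{[n]}(x)=A_f^{[n]}(x)$ holds for all $x\in I^n$.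
   Context: $I$ is a nonempty open subinterval of $\mathbb{R}$. "Increasing" means nondecreasing; $\mathrm{conv}(S)$ is the smallest interval containing $S\subseteq\mathbb{R}$. For a strictly increasing (not necessarily continuous) $f:I\to\mathbb{R}$, it is known that there is a unique increasing function $f^{(-1)}:\mathrm{conv}(f(I))\to I$ with $f^{(-1)}(f(x))=x$ for all $x\in I$ (the generalized inverse of $f$; it is continuous). For $n\in\mathbb{N}=\{1,2,\dots\}$ the $n$-variable generalized quasiarithmetic mean $A_f^{[n]}:I^n\to I$ is $$A^{[n]}_{f}(x):=f^{(-1)}\Big(\frac{f(x_1)+\dots+f(x_n)}{n}\Big)\qquad(x\in I^n).$$ When $f$ is continuous this is the standard quasiarithmetic mean. For $n\in\mathbb{N}$, the mean $\mathfrak{M}^{[n]}:\mathbb{R}^n\to\mathbb{R}$ is defined by $\mathfrak{M}^{[n]}(x)=0$ if $\min(x)\leq 0\leq\max(x)$, and $\mathfrak{M}^{[n]}(x)=\frac{x_1+\dots+x_n}{n}$ otherwise, where $\min(x)$ and $\max(x)$ are the smallest and largest coordinates of $x$. *)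

theory Defs
  imports "HOL-Analysis.Analysis"
begin

definition real_conv :: "real set \<Rightarrow> real set" where
  "real_conv S = is_interval hull S"

text \<open>
  The generalized inverse is pinned down by its characteristic property. Outside
  \<open>real_conv (f ` I)\<close> its value is \<open>undefined\<close> (this is what \<open>\<rightarrow>\<^sub>E\<close> demands), so that the
  description is unique; see \<open>ex1_gen_inverse\<close> below.
\<close>

definition is_gen_inverse :: "real set \<Rightarrow> (real \<Rightarrow> real) \<Rightarrow> (real \<Rightarrow> real) \<Rightarrow> bool" where
  "is_gen_inverse I f g \<longleftrightarrow>
     g \<in> real_conv (f ` I) \<rightarrow>\<^sub>E I \<and> mono_on (real_conv (f ` I)) g \<and> (\<forall>x\<in>I. g (f x) = x)"

definition gen_inverse :: "real set \<Rightarrow> (real \<Rightarrow> real) \<Rightarrow> real \<Rightarrow> real" where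
  "gen_inverse I f = (THE g. is_gen_inverse I f g)"

text \<open>
  An \<open>n\<close>-tuple is a function on the index set \<open>{1..n}\<close>, extended by \<open>undefined\<close>.
\<close>

definition tuples :: "real set \<Rightarrow> nat \<Rightarrow> (nat \<Rightarrow> real) set" where
  "tuples I n = {1..n} \<rightarrow>\<^sub>E I"

definition gen_qa_mean :: "real set \<Rightarrow> (real \<Rightarrow> real) \<Rightarrow> nat \<Rightarrow> (nat \<Rightarrow> real) \<Rightarrow> real" where
  "gen_qa_mean I f n x = gen_inverse I f ((\<Sum>i=1..n. f (x i)) / real n)"

definition zero_mean :: "nat \<Rightarrow> (nat \<Rightarrow> real) \<Rightarrow> real" where
  "zero_mean n x =
     (if Min (x ` {1..n}) \<le> 0 \<and> 0 \<le> Max (x ` {1..n}) then 0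
      else (\<Sum>i=1..n. x i) / real n)"

lemma real_conv_iff:
  "y \<in> real_conv S \<longleftrightarrow> (\<exists>a\<in>S. \<exists>b\<in>S. a \<le> y \<and> y \<le> b)"
proof
  let ?T = "{y. \<exists>a\<in>S. \<exists>b\<in>S. a \<le> y \<and> y \<le> b}"
  have "is_interval ?T"
    unfolding is_interval_1 by (blast intro: order_trans)
  moreover have "S \<subseteq> ?T" by auto
  ultimately have "real_conv S \<subseteq> ?T"
    unfolding real_conv_def by (intro hull_minimal)
  then show "y \<in> real_conv S \<Longrightarrow> \<exists>a\<in>S. \<exists>b\<in>S. a \<le> y \<and> y \<le> b" by blast
next
  assume "\<exists>a\<in>S. \<exists>b\<in>S. a \<le> y \<and> y \<le> b"
  then show "y \<in> real_conv S"
    unfolding real_conv_def hull_def is_interval_1 by blast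
qed

lemma ex1_gen_inverse:
  assumes I: "is_interval I" and f: "strict_mono_on I f"
  shows "\<exists>!g. is_gen_inverse I f g"
proof -
  let ?C = "real_conv (f ` I)"
  have sub: "f x \<in> ?C" if "x \<in> I" for x
    using that by (auto simp: real_conv_iff)
  have le_iff: "f x \<le> f y \<longleftrightarrow> x \<le> y" if "x \<in> I" "y \<in> I" for x y
    using f that by (rule strict_mono_on_less_eq)
  define g where "g = restrict (\<lambda>y. Sup {x\<in>I. f x \<le> y}) ?C"
  have ne: "{x\<in>I. f x \<le> y} \<noteq> {}" if "y \<in> ?C" for y
    using that by (auto simp: real_conv_iff)
  have bd: "\<exists>b\<in>I. \<forall>x\<in>{x\<in>I. f x \<le> y}. x \<le> b" if y: "y \<in> ?C" for y
  proof -
    obtain b where b: "b \<in> I" "y \<le> f b" using y by (auto simp: real_conv_iff)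
    have "x \<le> b" if "x \<in> I" "f x \<le> y" for x
      using le_iff[of x b] that b by linarith
    with b show ?thesis by blast
  qed
  have bdd: "bdd_above {x\<in>I. f x \<le> y}" if "y \<in> ?C" for y
    using bd[OF that] by (auto intro: bdd_aboveI)
  have "is_gen_inverse I f g"
    unfolding is_gen_inverse_def
  proof (intro conjI ballI)
    show "g \<in> ?C \<rightarrow>\<^sub>E I"
    proof (rule PiE_I)
      fix y assume y: "y \<in> ?C"
      obtain a where a: "a \<in> {x\<in>I. f x \<le> y}" using ne[OF y] by blast
      obtain b where b: "b \<in> I" "\<forall>x\<in>{x\<in>I. f x \<le> y}. x \<le> b" using bd[OF y] by blast
      have "a \<le> Sup {x\<in>I. f x \<le> y}" using a bdd[OF y] by (rule cSup_upper)
      moreover have "Sup {x\<in>I. f x \<le> y} \<le> b" using ne[OF y] b by (intro cSup_least) auto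
      ultimately have "Sup {x\<in>I. f x \<le> y} \<in> I"
        using I a b(1) unfolding is_interval_1 by blast
      then show "g y \<in> I" using y by (simp add: g_def)
    next
      fix y assume "y \<notin> ?C"
      then show "g y = undefined" by (simp add: g_def)
    qed
    show "mono_on ?C g"
    proof (rule mono_onI)
      fix r s assume rs: "r \<in> ?C" "s \<in> ?C" "r \<le> s"
      have "Sup {x\<in>I. f x \<le> r} \<le> Sup {x\<in>I. f x \<le> s}"
        using rs by (intro cSup_subset_mono ne bdd) auto
      then show "g r \<le> g s" using rs by (simp add: g_def)
    qed
    fix x assume x: "x \<in> I"
    have "Sup {z\<in>I. f z \<le> f x} = x"
      using x le_iff by (intro cSup_eq_maximum) auto
    then show "g (f x) = x" using sub[OF x] by (simp add: g_def)
  qed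
  moreover have False
    if g: "is_gen_inverse I f g" and h: "is_gen_inverse I f h"
      and y: "y \<in> ?C" and less: "g y < h y" for g h y
  proof -
    obtain x where x: "g y < x" "x < h y" using dense[OF less] by blast
    have "g y \<in> I" "h y \<in> I"
      using g h y unfolding is_gen_inverse_def by auto
    with x have xI: "x \<in> I"
      using I unfolding is_interval_1 by (meson less_imp_le)
    have gh: "g (f x) = x" "h (f x) = x"
      using g h xI unfolding is_gen_inverse_def by auto
    have m: "mono_on ?C g" "mono_on ?C h"
      using g h unfolding is_gen_inverse_def by auto
    show False
    proof (cases "f x \<le> y")
      case True
      then show False using mono_onD[OF m(1) sub[OF xI] y] gh x by simp
    next
      case False
      then show False using mono_onD[OF m(2) y sub[OF xI]] gh x by simp
    qed
  qed
  then have "g = h" if g: "is_gen_inverse I f g" and h: "is_gen_inverse I f h" for g h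
  proof -
    have "g y = h y" if "y \<in> ?C" for y
      using \<open>\<And>g h y. \<lbrakk>is_gen_inverse I f g; is_gen_inverse I f h; y \<in> ?C; g y < h y\<rbrakk> \<Longrightarrow> False\<close> g h that
      by (meson linorder_neqE_linordered_idom)
    moreover have "g \<in> ?C \<rightarrow>\<^sub>E I" "h \<in> ?C \<rightarrow>\<^sub>E I"
      using g h unfolding is_gen_inverse_def by auto
    ultimately show ?thesis by (intro PiE_ext) auto
  qed
  ultimately show ?thesis by blast
qed

end

theory Submission
  imports Defs
begin

text \<open>
  The value \<open>f\<^sup>(\<^sup>-\<^sup>1\<^sup>)(y)\<close> is the point \<open>m\<close> of \<open>I\<close> at which the graph of \<open>f\<close> crosses the height \<open>y\<close>,
  possibly inside a jump: \<open>f z \<le> y\<close> to the left of \<open>m\<close> and \<open>y \<le> f z\<close> to the right of it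
  (\<open>gen_inverse_eq_iff\<close>). An identity between \<open>zero_mean\<close> and a generalized quasiarithmetic mean
  thereby becomes a family of linear inequalities between values of \<open>f\<close>. All the negative results
  follow from these inequalities for tuples with one entry \<open>t\<close> and all other entries \<open>s\<close>
  (\<open>mean_eq_two_valued\<close>).

  If \<open>f\<close> is continuous and \<open>t > 0\<close>, the average of \<open>f\<close> over \<open>(t, 0, \<dots>, 0)\<close> is attained by \<open>f\<close> at a
  positive point, whereas the mean of that tuple is \<open>0\<close>; so \<open>f\<close> has to jump at \<open>0\<close>.
  A jump does work for one fixed \<open>n\<close> on a bounded interval: \<open>f x = x + K sgn x\<close> is affine on each
  side of \<open>0\<close>, so it generates the arithmetic mean there, and for large \<open>K\<close> the jump at \<open>0\<close> contains
  the average of \<open>f\<close> over every tuple that does not stay strictly on one side of \<open>0\<close>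
  (\<open>zero_mean_eq_jump_mean\<close>).

  Conversely, the tuples \<open>(t, 0, \<dots>, 0)\<close> bound \<open>f\<close> from above. If \<open>I\<close> were unbounded above,
  the average of \<open>f\<close> over \<open>(t, s, \<dots>, s)\<close> with \<open>s > 0\<close> would stay strictly below the supremum of \<open>f\<close>
  as \<open>t \<rightarrow> \<infinity>\<close>, so the mean would stay bounded; but it is the arithmetic mean, which tends to \<open>\<infinity>\<close>
  (\<open>bdd_above_of_two_valued_inequalities\<close>). The lower end is the same for \<open>x \<mapsto> - f (- x)\<close>.

  Finally, if one \<open>f\<close> served all \<open>n\<close>, the tuples \<open>(0, s, \<dots>, s)\<close> with \<open>s > 0\<close>, whose mean is \<open>0\<close>, would
  have \<open>f\<close>-averages converging to \<open>f s\<close> while bounded by \<open>f r\<close> for every \<open>r > 0\<close>; this is absurd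
  for \<open>r < s\<close>.
\<close>

section \<open>The generalized inverse as a crossing point\<close>

text \<open>
  From left to right, \<open>f z > y\<close> would force \<open>z \<ge> f\<^sup>(\<^sup>-\<^sup>1\<^sup>)(y)\<close> by monotonicity, and symmetrically. From right
  to left, two different crossing points would leave room for some \<open>z \<in> I\<close> strictly between them,
  and monotonicity at \<open>f z\<close> excludes that.
\<close>

lemma gen_inverse_eq_iff:
  assumes I: "is_interval I" and f: "strict_mono_on I f"
    and y: "y \<in> real_conv (f ` I)" and m: "m \<in> I"
  shows "gen_inverse I f y = m \<longleftrightarrow>
    (\<forall>z\<in>I. (z < m \<longrightarrow> f z \<le> y) \<and> (m < z \<longrightarrow> y \<le> f z))"
proof -
  define g where "g = gen_inverse I f"
  have "is_gen_inverse I f g"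
    unfolding g_def gen_inverse_def by (rule theI'[OF ex1_gen_inverse[OF I f]])
  then have gI: "g \<in> real_conv (f ` I) \<rightarrow>\<^sub>E I" and mono: "mono_on (real_conv (f ` I)) g"
    and inv: "\<And>x. x \<in> I \<Longrightarrow> g (f x) = x"
    by (auto simp: is_gen_inverse_def)
  have fC: "f z \<in> real_conv (f ` I)" if "z \<in> I" for z
    using that by (auto simp: real_conv_iff)
  have gy: "g y \<in> I" using gI y by auto
  have left: "f z \<le> y" if "z \<in> I" "z < g y" for z
    using mono_onD[OF mono y fC[OF that(1)]] inv[OF that(1)] that(2) by force
  have right: "y \<le> f z" if "z \<in> I" "g y < z" for z
    using mono_onD[OF mono fC[OF that(1)] y] inv[OF that(1)] that(2) by force
  have mid: "z \<in> I" if "a \<in> I" "b \<in> I" "a < z" "z < b" for a b z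
    using I that unfolding is_interval_1 by (meson less_imp_le)
  have "g y = m" if cross: "\<forall>z\<in>I. (z < m \<longrightarrow> f z \<le> y) \<and> (m < z \<longrightarrow> y \<le> f z)"
  proof (cases "g y" m rule: linorder_cases)
    case less
    then obtain z where z: "g y < z" "z < m" using dense by blast
    then have zI: "z \<in> I" using mid gy m by blast
    with cross z have "g (f z) \<le> g y" using mono_onD[OF mono fC[OF zI] y] by blast
    then show ?thesis using inv[OF zI] z by simp
  next
    case greater
    then obtain z where z: "m < z" "z < g y" using dense by blast
    then have zI: "z \<in> I" using mid gy m by blast
    with cross z have "g y \<le> g (f z)" using mono_onD[OF mono y fC[OF zI]] by blast
    then show ?thesis using inv[OF zI] z by simp
  qed
  then show ?thesis using left right unfolding g_def by blast
qed

section \<open>Averages of tuples\<close>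

lemma average_between:
  fixes h :: "nat \<Rightarrow> real"
  assumes "n \<ge> 1" and "\<And>i. i \<in> {1..n} \<Longrightarrow> a \<le> h i \<and> h i \<le> b"
  shows "a \<le> (\<Sum>i=1..n. h i) / real n" "(\<Sum>i=1..n. h i) / real n \<le> b"
proof -
  have "(\<Sum>i=1..n. a) \<le> (\<Sum>i=1..n. h i)" "(\<Sum>i=1..n. h i) \<le> (\<Sum>i=1..n. b)"
    by (intro sum_mono; use assms in auto)+
  then show "a \<le> (\<Sum>i=1..n. h i) / real n" "(\<Sum>i=1..n. h i) / real n \<le> b"
    using assms(1) by (auto simp: field_simps)
qed

lemma average_in_real_conv:
  assumes "n \<ge> 1" and x: "x \<in> tuples I n"
  shows "(\<Sum>i=1..n. f (x i)) / real n \<in> real_conv (f ` I)"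
proof -
  let ?A = "(\<lambda>i. f (x i)) ` {1..n}"
  have A: "finite ?A" "?A \<noteq> {}" using assms by auto
  have "?A \<subseteq> f ` I" using x by (auto simp: tuples_def)
  with Min_in[OF A] Max_in[OF A] have ends: "Min ?A \<in> f ` I" "Max ?A \<in> f ` I" by blast+
  have "Min ?A \<le> f (x i) \<and> f (x i) \<le> Max ?A" if "i \<in> {1..n}" for i
    using that by (auto intro!: Min_le Max_ge)
  from average_between[of n "Min ?A" "\<lambda>i. f (x i)" "Max ?A", OF assms(1) this] ends show ?thesis
    unfolding real_conv_iff by blast
qed

lemma zero_mean_in_interval:
  assumes I: "is_interval I" "0 \<in> I" and "n \<ge> 1" and x: "x \<in> tuples I n"
  shows "zero_mean n x \<in> I"
proof -
  have "(\<Sum>i=1..n. x i) / real n \<in> real_conv (id ` I)"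
    using average_in_real_conv[OF assms(3,4), of id] by simp
  then obtain a b where "a \<in> I" "b \<in> I"
      "a \<le> (\<Sum>i=1..n. x i) / real n" "(\<Sum>i=1..n. x i) / real n \<le> b"
    unfolding real_conv_iff by auto
  then have "(\<Sum>i=1..n. x i) / real n \<in> I"
    by (rule mem_is_interval_1_I[OF I(1)])
  then show ?thesis unfolding zero_mean_def using I(2) by presburger
qed

definition two_valued :: "nat \<Rightarrow> real \<Rightarrow> real \<Rightarrow> nat \<Rightarrow> real" where
  "two_valued n s t = (\<lambda>i\<in>{1..n}. if i = 1 then t else s)"

lemma two_valued_in_tuples: "s \<in> I \<Longrightarrow> t \<in> I \<Longrightarrow> two_valued n s t \<in> tuples I n"
  by (auto simp: two_valued_def tuples_def)

lemma sum_two_valued: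
  fixes h :: "real \<Rightarrow> real"
  assumes "n \<ge> 1"
  shows "(\<Sum>i=1..n. h (two_valued n s t i)) = (real n - 1) * h s + h t"
proof -
  have "{1..n} = insert 1 {2..n}" using assms by auto
  moreover have "(\<Sum>i=2..n. h (two_valued n s t i)) = (\<Sum>i=2..n. h s)"
    by (intro sum.cong) (auto simp: two_valued_def)
  ultimately show ?thesis
    using assms by (simp add: two_valued_def of_nat_diff)
qed

lemma zero_mean_two_valued:
  assumes "n \<ge> 2"
  shows "zero_mean n (two_valued n s t) =
    (if min s t \<le> 0 \<and> 0 \<le> max s t then 0 else ((real n - 1) * s + t) / real n)"
proof -
  have "two_valued n s t 1 = t" "two_valued n s t 2 = s"
    using assms by (auto simp: two_valued_def)
  moreover have "1 \<in> {1..n}" "2 \<in> {1..n}" using assms by auto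
  ultimately have "{s, t} \<subseteq> two_valued n s t ` {1..n}"
    by (metis imageI insert_subset empty_subsetI)
  moreover have "two_valued n s t ` {1..n} \<subseteq> {s, t}" by (auto simp: two_valued_def)
  ultimately have "two_valued n s t ` {1..n} = {s, t}" by blast
  then show ?thesis
    using sum_two_valued[of n "\<lambda>u. u" s t] assms by (simp add: zero_mean_def)
qed

section \<open>Necessary conditions from two-valued tuples\<close>

lemma mean_eq_two_valued:
  assumes I: "is_interval I" "0 \<in> I" and f: "strict_mono_on I f" and n: "n \<ge> 2"
    and eq: "\<forall>x\<in>tuples I n. zero_mean n x = gen_qa_mean I f n x"
    and "s \<in> I" "t \<in> I" "z \<in> I"
  shows "z < zero_mean n (two_valued n s t) \<Longrightarrow> real n * f z \<le> (real n - 1) * f s + f t"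
    and "zero_mean n (two_valued n s t) < z \<Longrightarrow> (real n - 1) * f s + f t \<le> real n * f z"
proof -
  let ?x = "two_valued n s t" and ?y = "((real n - 1) * f s + f t) / real n"
  have n1: "n \<ge> 1" using n by simp
  have x: "?x \<in> tuples I n" using assms by (intro two_valued_in_tuples)
  have avg: "(\<Sum>i=1..n. f (?x i)) / real n = ?y" using sum_two_valued[OF n1] by simp
  have "gen_inverse I f ?y = gen_qa_mean I f n ?x"
    unfolding gen_qa_mean_def avg ..
  then have "gen_inverse I f ?y = zero_mean n ?x" using eq x by simp
  moreover have "?y \<in> real_conv (f ` I)"
    using average_in_real_conv[OF n1 x, of f] unfolding avg .
  ultimately have "\<forall>z\<in>I. (z < zero_mean n ?x \<longrightarrow> f z \<le> ?y) \<and> (zero_mean n ?x < z \<longrightarrow> ?y \<le> f z)"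
    using gen_inverse_eq_iff[OF I(1) f] zero_mean_in_interval[OF I n1 x] by blast
  then show "z < zero_mean n ?x \<Longrightarrow> real n * f z \<le> (real n - 1) * f s + f t"
    and "zero_mean n ?x < z \<Longrightarrow> (real n - 1) * f s + f t \<le> real n * f z"
    using \<open>z \<in> I\<close> n by (auto simp: field_simps)
qed

lemma continuous_generator_impossible:
  assumes I: "is_interval I" "0 \<in> I" and t: "t \<in> I" "0 < t"
    and f: "strict_mono_on I f" "continuous_on I f" and n: "n \<ge> 2"
    and eq: "\<forall>x\<in>tuples I n. zero_mean n x = gen_qa_mean I f n x"
  shows False
proof -
  have sub: "{0..t} \<subseteq> I" using mem_is_interval_1_I[OF I t(1)] by auto
  let ?y = "((real n - 1) * f 0 + f t) / real n"
  have ft: "f 0 < f t" using f(1) I t by (simp add: strict_mono_onD)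
  then have "(real n - 1) * f 0 \<le> (real n - 1) * f t" using n by (intro mult_left_mono) auto
  then have y: "f 0 < ?y" "?y \<le> f t" using ft n by (auto simp: field_simps)
  then obtain z where z: "0 \<le> z" "z \<le> t" "f z = ?y"
    using IVT'[of f 0 ?y t] t continuous_on_subset[OF f(2) sub] by auto
  have "z \<noteq> 0" using y(1) z(3) by force
  with z have "0 < z" by simp
  then have zI: "z \<in> I" "z / 2 \<in> I" using sub z by auto
  have "zero_mean n (two_valued n 0 t) = 0" using zero_mean_two_valued[OF n] t by simp
  then have "(real n - 1) * f 0 + f t \<le> real n * f (z / 2)"
    using mean_eq_two_valued(2)[OF I f(1) n eq I(2) t(1) zI(2)] \<open>0 < z\<close> by simp
  then have "?y \<le> f (z / 2)" using n by (simp add: field_simps)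
  moreover have "f (z / 2) < f z" using f(1) zI \<open>0 < z\<close> by (simp add: strict_mono_onD)
  ultimately show False using z(3) by simp
qed

text \<open>
  The hypotheses are stated for \<open>f\<close> alone rather than for means so that the lemma also applies to the
  reflection \<open>x \<mapsto> - f (- x)\<close>. The first one bounds \<open>f\<close> on an unbounded \<open>I\<close>, and then the second
  one cannot hold for large \<open>t\<close> with \<open>f u\<close> close to the supremum of \<open>f\<close>.
\<close>

lemma bdd_above_of_two_valued_inequalities:
  fixes f :: "real \<Rightarrow> real"
  assumes I: "is_interval I" "0 \<in> I" and f: "strict_mono_on I f" and n: "n \<ge> 2"
    and zero: "\<And>t z. t \<in> I \<Longrightarrow> z \<in> I \<Longrightarrow> 0 < t \<Longrightarrow> 0 < z \<Longrightarrow>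
      (real n - 1) * f 0 + f t \<le> real n * f z"
    and pos: "\<And>s t u. s \<in> I \<Longrightarrow> t \<in> I \<Longrightarrow> u \<in> I \<Longrightarrow> 0 < s \<Longrightarrow> 0 < t \<Longrightarrow>
      u < ((real n - 1) * s + t) / real n \<Longrightarrow> real n * f u \<le> (real n - 1) * f s + f t"
  shows "bdd_above I"
proof (rule ccontr)
  assume unb: "\<not> bdd_above I"
  have ray: "x \<in> I" if "0 \<le> x" for x
  proof -
    obtain b where "b \<in> I" "x \<le> b" using unb unfolding bdd_above_def by (meson linear)
    then show ?thesis using I that unfolding is_interval_1 by blast
  qed
  define L where "L = Sup (f ` {0<..})"
  have bdd: "bdd_above (f ` {0<..})"
  proof (rule bdd_aboveI2)
    show "f t \<le> real n * f 1 - (real n - 1) * f 0" if "t \<in> {0<..}" for t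
      using zero[of t 1] ray that by (simp add: algebra_simps)
  qed
  have upper: "f t \<le> L" if "0 < t" for t
    unfolding L_def using that by (intro cSup_upper bdd) auto
  have "f 1 < f 2" using f ray by (intro strict_mono_onD[OF f]) auto
  then have "f 1 < L" using upper[of 2] by simp
  then have "(real n - 1) * f 1 < (real n - 1) * L" using n by simp
  then have "((real n - 1) * f 1 + L) / real n < L"
    using n by (simp add: field_simps)
  then obtain u where u: "0 < u" "((real n - 1) * f 1 + L) / real n < f u"
    unfolding L_def using less_cSup_iff[OF _ bdd] by auto
  \<comment> \<open>Large enough for the arithmetic mean of \<open>(t, 1, \<dots>, 1)\<close> to exceed \<open>u\<close>.\<close>
  let ?t = "real n * u + 1"
  have t: "0 < ?t" using u by (simp add: add_nonneg_pos)
  have "u < ((real n - 1) * 1 + ?t) / real n" using n by (simp add: field_simps)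
  then have "real n * f u \<le> (real n - 1) * f 1 + f ?t"
    using pos[of 1 ?t u] ray u t by simp
  also have "\<dots> \<le> (real n - 1) * f 1 + L" using upper[OF t] by simp
  finally show False using u(2) n by (simp add: field_simps)
qed

lemma generator_imp_bounded:
  assumes I: "is_interval I" "0 \<in> I" and f: "strict_mono_on I f" and n: "n \<ge> 2"
    and eq: "\<forall>x\<in>tuples I n. zero_mean n x = gen_qa_mean I f n x"
  shows "bounded I"
proof -
  note two = mean_eq_two_valued[OF I f n eq]
  have "bdd_above I"
  proof (rule bdd_above_of_two_valued_inequalities[OF I f n])
    show "(real n - 1) * f 0 + f t \<le> real n * f z" if "t \<in> I" "z \<in> I" "0 < t" "0 < z" for t z
      using two(2)[of 0 t z] zero_mean_two_valued[OF n, of 0 t] I that by simp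
    show "real n * f u \<le> (real n - 1) * f s + f t"
      if "s \<in> I" "t \<in> I" "u \<in> I" "0 < s" "0 < t" "u < ((real n - 1) * s + t) / real n" for s t u
      using two(1)[of s t u] zero_mean_two_valued[OF n, of s t] that by (simp add: min_def)
  qed
  moreover have "bdd_above (uminus ` I)"
  proof (rule bdd_above_of_two_valued_inequalities[where f = "\<lambda>x. - f (- x)", OF _ _ _ n])
    show "is_interval (uminus ` I)" using I(1) by simp
    show "0 \<in> uminus ` I" using I(2) by force
    show "strict_mono_on (uminus ` I) (\<lambda>x. - f (- x))"
      using f by (auto simp: strict_mono_on_def)
    show "(real n - 1) * - f (- 0) + - f (- t) \<le> real n * - f (- z)"
      if "t \<in> uminus ` I" "z \<in> uminus ` I" "0 < t" "0 < z" for t z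
    proof -
      have "- t \<in> I" "- z \<in> I" using that by auto
      then show ?thesis
        using two(1)[of 0 "- t" "- z"] zero_mean_two_valued[OF n, of 0 "- t"] I that
        by (simp add: algebra_simps)
    qed
    show "real n * - f (- u) \<le> (real n - 1) * - f (- s) + - f (- t)"
      if "s \<in> uminus ` I" "t \<in> uminus ` I" "u \<in> uminus ` I" "0 < s" "0 < t"
        "u < ((real n - 1) * s + t) / real n" for s t u
    proof -
      have "- s \<in> I" "- t \<in> I" "- u \<in> I" using that by auto
      moreover have "((real n - 1) * - s + - t) / real n < - u"
        using that(6) n by (simp add: field_simps)
      ultimately show ?thesis
        using two(2)[of "- s" "- t" "- u"] zero_mean_two_valued[OF n, of "- s" "- t"] that
        by (simp add: max_def algebra_simps)
    qed
  qed
  ultimately obtain a b where "\<And>u. u \<in> I \<Longrightarrow> u \<le> a" "\<And>u. u \<in> I \<Longrightarrow> - u \<le> b"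
    by (auto simp: bdd_above_def)
  then have "I \<subseteq> {- b..a}" by (auto simp: minus_le_iff)
  then show ?thesis by (rule bounded_subset[OF bounded_closed_interval])
qed

lemma common_generator_impossible:
  assumes I: "is_interval I" "0 \<in> I" and s: "s \<in> I" "0 < s" and f: "strict_mono_on I f"
    and eq: "\<forall>n\<ge>1. \<forall>x\<in>tuples I n. zero_mean n x = gen_qa_mean I f n x"
  shows False
proof -
  let ?r = "s / 2"
  have r: "?r \<in> I" "0 < ?r" using I s mem_is_interval_1_I[OF I(1) I(2) s(1), of ?r] by auto
  have gap: "f ?r < f s" using strict_mono_onD[OF f] r s by simp
  have bound: "(real n - 1) * (f s - f ?r) \<le> f ?r - f 0" if n: "n \<ge> 2" for n
  proof -
    have "zero_mean n (two_valued n s 0) = 0" using zero_mean_two_valued[OF n] s by simp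
    then have "(real n - 1) * f s + f 0 \<le> real n * f ?r"
      using mean_eq_two_valued(2)[OF I f n _ s(1) I(2) r(1)] eq n r(2) by simp
    then show ?thesis by (simp add: algebra_simps)
  qed
  obtain k :: nat where k: "f ?r - f 0 < real k * (f s - f ?r)"
    using ex_less_of_nat_mult[of "f s - f ?r" "f ?r - f 0"] gap by auto
  have "real k * (f s - f ?r) \<le> (real (k + 2) - 1) * (f s - f ?r)"
    using gap by (intro mult_right_mono) auto
  with bound[of "k + 2"] k show False by simp
qed

section \<open>A generator with a jump on a bounded interval\<close>

text \<open>
  The constant \<open>K = (n - 1) B\<close> is large enough because a tuple with a nonpositive entry has at
  most \<open>n - 1\<close> positive ones, each contributing at most \<open>B + K\<close>, and \<open>(n - 1) (B + K) = n K\<close>.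
  Applied to \<open>- x\<close>, the estimate also gives the lower end of the jump.
\<close>

lemma average_jump_le:
  fixes x :: "nat \<Rightarrow> real"
  assumes n: "n \<ge> 1" and K: "K = (real n - 1) * B" "0 \<le> B"
    and x: "\<And>i. i \<in> {1..n} \<Longrightarrow> x i \<le> B" and j: "j \<in> {1..n}" "x j \<le> 0"
  shows "(\<Sum>i=1..n. x i + K * sgn (x i)) / real n \<le> K"
proof -
  let ?f = "\<lambda>u. u + K * sgn u"
  have K0: "0 \<le> K" using K n by simp
  have le: "?f (x i) \<le> B + K" if "i \<in> {1..n}" for i
    using x[OF that] K0 K(2) by (auto simp: sgn_real_def)
  have "?f (x j) \<le> 0" using j K0 by (auto simp: sgn_real_def)
  moreover have "(\<Sum>i\<in>{1..n}-{j}. ?f (x i)) \<le> (\<Sum>i\<in>{1..n}-{j}. B + K)"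
    using le by (intro sum_mono) auto
  moreover have "(\<Sum>i=1..n. ?f (x i)) = ?f (x j) + (\<Sum>i\<in>{1..n}-{j}. ?f (x i))"
    using j by (intro sum.remove) auto
  ultimately have "(\<Sum>i=1..n. ?f (x i)) \<le> (real n - 1) * (B + K)"
    using j n by (simp add: of_nat_diff)
  also have "\<dots> = real n * K" unfolding K(1) by (simp add: algebra_simps)
  finally show ?thesis using n by (simp add: field_simps)
qed

lemma strict_mono_on_jump:
  assumes "0 \<le> (K::real)"
  shows "strict_mono_on I (\<lambda>u::real. u + K * sgn u)"
  using assms by (auto simp: strict_mono_on_def sgn_real_def)

lemma zero_mean_eq_jump_mean:
  assumes I: "is_interval I" "0 \<in> I" and n: "n \<ge> 1"
    and K: "K = (real n - 1) * B" "0 \<le> B" and B: "\<And>u. u \<in> I \<Longrightarrow> \<bar>u\<bar> \<le> B"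
    and x: "x \<in> tuples I n"
  shows "zero_mean n x = gen_qa_mean I (\<lambda>u. u + K * sgn u) n x"
proof -
  let ?f = "\<lambda>u. u + K * sgn u" and ?m = "(\<Sum>i=1..n. x i) / real n"
  let ?y = "(\<Sum>i=1..n. ?f (x i)) / real n"
  have K0: "0 \<le> K" using K n by simp
  have f: "strict_mono_on I ?f" using K0 by (rule strict_mono_on_jump)
  have xI: "x i \<in> I" if "i \<in> {1..n}" for i using x that by (auto simp: tuples_def)
  have A: "finite (x ` {1..n})" "x ` {1..n} \<noteq> {}" using n by auto
  have iff: "gen_inverse I ?f ?y = zero_mean n x \<longleftrightarrow>
      (\<forall>z\<in>I. (z < zero_mean n x \<longrightarrow> ?f z \<le> ?y) \<and> (zero_mean n x < z \<longrightarrow> ?y \<le> ?f z))"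
    by (rule gen_inverse_eq_iff[OF I(1) f average_in_real_conv[OF n x] zero_mean_in_interval[OF I n x]])
  \<comment> \<open>On tuples of constant sign \<open>c\<close> the function is the translation by \<open>c K\<close>.\<close>
  have one_sided: "gen_inverse I ?f ?y = zero_mean n x"
    if zm: "zero_mean n x = ?m" and c: "\<And>i. i \<in> {1..n} \<Longrightarrow> sgn (x i) = c" "sgn ?m = c" for c
  proof -
    have "(\<Sum>i=1..n. ?f (x i)) = (\<Sum>i=1..n. x i + K * c)"
      using c(1) by (intro sum.cong) auto
    then have "?y = ?f ?m" using c(2) n by (simp add: sum.distrib field_simps)
    then show ?thesis
      unfolding iff unfolding zm
      using strict_mono_on_less_eq[OF f] zero_mean_in_interval[OF I n x] zm
      by (metis less_imp_le)
  qed
  consider "Min (x ` {1..n}) > 0" | "Max (x ` {1..n}) < 0"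
    | "Min (x ` {1..n}) \<le> 0" "0 \<le> Max (x ` {1..n})" by linarith
  then have "gen_inverse I ?f ?y = zero_mean n x"
  proof cases
    case 1
    then have "0 < x i" if "i \<in> {1..n}" for i using A that by auto
    moreover from this have "0 < ?m" using n by (auto intro!: divide_pos_pos sum_pos)
    moreover have "zero_mean n x = ?m" using 1 by (simp add: zero_mean_def)
    ultimately show ?thesis by (intro one_sided[of 1] sgn_pos)
  next
    case 2
    then have neg: "x i < 0" if "i \<in> {1..n}" for i using A that by auto
    then have "0 < (\<Sum>i=1..n. - x i)" using n by (intro sum_pos) auto
    then have "?m < 0" using n by (auto simp: sum_negf divide_less_0_iff)
    moreover have "zero_mean n x = ?m" using 2 by (simp add: zero_mean_def)
    ultimately show ?thesis using neg by (intro one_sided[of "- 1"] sgn_neg)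
  next
    case 3
    obtain j where j: "j \<in> {1..n}" "x j \<le> 0" using Min_in[OF A] 3(1) by auto
    obtain k where k: "k \<in> {1..n}" "0 \<le> x k" using Max_in[OF A] 3(2) by auto
    have "?y \<le> K"
      by (rule average_jump_le[OF n K, of x j]) (use B xI j in force)+
    moreover have "(\<Sum>i=1..n. - x i + K * sgn (- x i)) / real n \<le> K"
      by (rule average_jump_le[OF n K, of "\<lambda>i. - x i" k]) (use B xI k in force)+
    then have "- K \<le> ?y"
      using n by (simp add: sgn_minus sum_negf sum_subtractf sum.distrib field_simps)
    ultimately show ?thesis
      unfolding iff using 3 by (auto simp: zero_mean_def)
  qed
  then show ?thesis by (simp add: gen_qa_mean_def)
qed

lemma bounded_imp_generator:
  assumes I: "is_interval I" "0 \<in> I" and n: "n \<ge> 1" and "bounded I"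
  shows "\<exists>f. strict_mono_on I f \<and> (\<forall>x\<in>tuples I n. zero_mean n x = gen_qa_mean I f n x)"
proof -
  obtain B where B: "\<And>u. u \<in> I \<Longrightarrow> \<bar>u\<bar> \<le> B"
    using \<open>bounded I\<close> by (auto simp: bounded_iff)
  define K where "K = (real n - 1) * B"
  have "0 \<le> B" using B[OF I(2)] by simp
  moreover from this have "0 \<le> K" using n by (simp add: K_def)
  ultimately show ?thesis
    using strict_mono_on_jump zero_mean_eq_jump_mean[OF I n K_def _ B] by blast
qed

theorem proposition5p1:
  fixes I :: "real set"
  assumes "I \<noteq> {}" and "open I" and "is_interval I" and "0 \<in> I"
  shows "(\<forall>n\<ge>2. \<not> (\<exists>f. strict_mono_on I f \<and> continuous_on I f \<and>
             (\<forall>x\<in>tuples I n. zero_mean n x = gen_qa_mean I f n x))) \<and>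
         (\<forall>n\<ge>2. (\<exists>f. strict_mono_on I f \<and>
             (\<forall>x\<in>tuples I n. zero_mean n x = gen_qa_mean I f n x)) \<longleftrightarrow> bounded I) \<and>
         \<not> (\<exists>f. strict_mono_on I f \<and>
             (\<forall>n\<ge>1. \<forall>x\<in>tuples I n. zero_mean n x = gen_qa_mean I f n x))"
proof -
  note I = \<open>is_interval I\<close> \<open>0 \<in> I\<close>
  obtain e where "0 < e" "cball 0 e \<subseteq> I"
    using \<open>open I\<close> \<open>0 \<in> I\<close> open_contains_cball by blast
  then have t: "e \<in> I" "0 < e" by auto
  show ?thesis
  proof (intro conjI allI impI)
    show "\<not> (\<exists>f. strict_mono_on I f \<and> continuous_on I f \<and>
        (\<forall>x\<in>tuples I n. zero_mean n x = gen_qa_mean I f n x))" if "n \<ge> 2" for n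
      using continuous_generator_impossible[OF I t _ _ that] by blast
    show "(\<exists>f. strict_mono_on I f \<and>
        (\<forall>x\<in>tuples I n. zero_mean n x = gen_qa_mean I f n x)) \<longleftrightarrow> bounded I" if "n \<ge> 2" for n
      using generator_imp_bounded[OF I _ that] bounded_imp_generator[OF I, of n] that by auto
    show "\<not> (\<exists>f. strict_mono_on I f \<and>
        (\<forall>n\<ge>1. \<forall>x\<in>tuples I n. zero_mean n x = gen_qa_mean I f n x))"
      using common_generator_impossible[OF I t] by blast
  qed
qed

end
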